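(* Let $s,z,t,K$ be indeterminates, put $\gamma_1=(t-1)(t+1)$, $\gamma_2=zt-1$, $\gamma_3=t-z$, and for any value $L$ of the last variable define $$a(L)=z^2-(t+t^{-1})z+1,\quad b(L)=-\frac{(t^2+1)\gamma_2\gamma_3}{\gamma_1^2}-\frac{t\gamma_2^2}{L^2\gamma_1^2}-\frac{L^2\gamma_3^2t}{\gamma_1^2},$$ $$d(L)=-\frac{2t\gamma_2\gamma_3}{\gamma_1^2}-\frac{\gamma_2^2}{L^2\gamma_1^2}-\frac{L^2t^2\gamma_3^2}{\gamma_1^2},\quad \alpha(L)=-\frac{\gamma_2}{(1-t^2)L}-\frac{L\gamma_3t}{1-t^2}.$$ Let $f(x;K)$ be the formal power series in $x$ with constant term $1$ satisfying $$\big(a(K)x^4-sb(K)x^3+b(K)x^2\big)f(x;K)^2+\big(((t+t^{-1})d(K)-2b(K))x^2-sd(K)x+d(K)\big)f(x;K)=d(K).$$ Then $$f(x;K)=\cfrac{1}{1-sx-\cfrac{\frac{\alpha(-tK)}{\alpha(K)}x^2}{1-\cfrac{\frac{\alpha(K)}{\alpha(-tK)}x^2}{1-sx-\cfrac{\frac{\alpha(t^2K)}{\alpha(-tK)}x^2}{1-\cfrac{\frac{\alpha(-tK)}{\alpha(t^2K)}x^2}{\ddots}}}}},$$ i.e. the $J$-fraction with $u_{2j+1}=-s$, $u_{2j+2}=0$, $v_0=1$, $v_{2j+1}=\alpha((-t)^{j+1}K)/\alpha((-t)^jK)$, $v_{2j+2}=\alpha((-t)^jK)/\alpha((-t)^{j+1}K)$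 for $j\ge0$.
   Context: All series are formal power series in $x$ with coefficients rational functions of $s,z,t,K$. A $J$-fraction with sequences $(u_1,u_2,\dots)$, $(v_0,v_1,\dots)$ is $\cfrac{v_0}{1+u_1x-\cfrac{v_1x^2}{1+u_2x-\cdots}}$. *)

theory Defs
  imports "HOL-Computational_Algebra.Computational_Algebra"
begin

(* Rational functions in four indeterminates over a field: the fraction field of an iterated
   polynomial ring. From the innermost to the outermost polynomial layer the indeterminates
   are s, z, t, K. *)
type_synonym 'a ratfun = "'a poly poly poly poly fract"

definition var_s :: "'a::field_char_0 ratfun" where
  "var_s = to_fract [:[:[:[:0, 1:]:]:]:]"

definition var_z :: "'a::field_char_0 ratfun" where
  "var_z = to_fract [:[:[:0, 1:]:]:]"

definition var_t :: "'a::field_char_0 ratfun" where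
  "var_t = to_fract [:[:0, 1:]:]"

definition var_K :: "'a::field_char_0 ratfun" where
  "var_K = to_fract [:0, 1:]"

definition gamma1 :: "'a::field \<Rightarrow> 'a" where
  "gamma1 t = (t - 1) * (t + 1)"

definition gamma2 :: "'a::field \<Rightarrow> 'a \<Rightarrow> 'a" where
  "gamma2 z t = z * t - 1"

definition gamma3 :: "'a::field \<Rightarrow> 'a \<Rightarrow> 'a" where
  "gamma3 z t = t - z"

(* Does not depend on L; the argument is kept for uniformity with b, d, alpha. *)
definition coeff_a :: "'a::field \<Rightarrow> 'a \<Rightarrow> 'a \<Rightarrow> 'a" where
  "coeff_a z t L = z ^ 2 - (t + inverse t) * z + 1"

definition coeff_b :: "'a::field \<Rightarrow> 'a \<Rightarrow> 'a \<Rightarrow> 'a" where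
  "coeff_b z t L =
     - ((t ^ 2 + 1) * gamma2 z t * gamma3 z t / gamma1 t ^ 2)
     - t * gamma2 z t ^ 2 / (L ^ 2 * gamma1 t ^ 2)
     - L ^ 2 * gamma3 z t ^ 2 * t / gamma1 t ^ 2"

definition coeff_d :: "'a::field \<Rightarrow> 'a \<Rightarrow> 'a \<Rightarrow> 'a" where
  "coeff_d z t L =
     - (2 * t * gamma2 z t * gamma3 z t / gamma1 t ^ 2)
     - gamma2 z t ^ 2 / (L ^ 2 * gamma1 t ^ 2)
     - L ^ 2 * t ^ 2 * gamma3 z t ^ 2 / gamma1 t ^ 2"

definition coeff_alpha :: "'a::field \<Rightarrow> 'a \<Rightarrow> 'a \<Rightarrow> 'a" where
  "coeff_alpha z t L =
     - (gamma2 z t / ((1 - t ^ 2) * L)) - L * gamma3 z t * t / (1 - t ^ 2)"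

definition quadratic_eq :: "'a::field \<Rightarrow> 'a \<Rightarrow> 'a \<Rightarrow> 'a \<Rightarrow> 'a fps \<Rightarrow> bool" where
  "quadratic_eq s z t K f \<longleftrightarrow>
     (let a = coeff_a z t K; b = coeff_b z t K; d = coeff_d z t K in
       (fps_const a * fps_X ^ 4 - fps_const (s * b) * fps_X ^ 3 + fps_const b * fps_X ^ 2) * f ^ 2
       + (fps_const ((t + inverse t) * d - 2 * b) * fps_X ^ 2 - fps_const (s * d) * fps_X
          + fps_const d) * f
       = fps_const d)"

(* J_convergent u v k n is the J-fraction starting at level k, with n levels kept:
   v_k / (1 + u_{k+1} x - v_{k+1} x^2 / ( ... / (1 + u_{k+n} x))).
   The value u 0 is never used. *)
fun J_convergent :: "(nat \<Rightarrow> 'a::field) \<Rightarrow> (nat \<Rightarrow> 'a) \<Rightarrow> nat \<Rightarrow> nat \<Rightarrow> 'a fps" where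
  "J_convergent u v k 0 = 0"
| "J_convergent u v k (Suc n) =
     fps_const (v k) /
       (1 + fps_const (u (Suc k)) * fps_X - fps_X ^ 2 * J_convergent u v (Suc k) n)"

(* The limit is taken in the library's metric on formal power series, i.e. the x-adic one:
   every coefficient of the convergents is eventually constant. *)
definition has_J_fraction ::
    "'a::field fps \<Rightarrow> (nat \<Rightarrow> 'a) \<Rightarrow> (nat \<Rightarrow> 'a) \<Rightarrow> bool" where
  "has_J_fraction f u v \<longleftrightarrow> (\<lambda>n. J_convergent u v 0 n) \<longlonglongrightarrow> f"

end

theory Submission
  imports Defs
begin

text \<open>
  Put \<open>A\<^sub>j = \<alpha>((-t)\<^sup>jK)\<close>. Then \<open>d(K) = -A\<^sub>0\<^sup>2\<close>, \<open>b(K) = A\<^sub>0A\<^sub>-\<^sub>1\<close>, \<open>a(K) = A\<^sub>0\<^sup>2 - A\<^sub>1A\<^sub>-\<^sub>1\<close>, and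
  \<open>A\<^sub>1 + A\<^sub>-\<^sub>1 = -(t + t\<^sup>-\<^sup>1)A\<^sub>0\<close>, so the quadratic equation only involves three consecutive
  terms of this sequence. Because \<open>a\<close> is independent of the last variable, the substitution
  \<open>f = 1 / (1 - sx - (A\<^sub>1/A\<^sub>0)x\<^sup>2 / (1 - (A\<^sub>0/A\<^sub>1)x\<^sup>2g))\<close> turns the equation at \<open>-tK\<close> for \<open>g\<close>
  into the equation at \<open>K\<close> for \<open>f\<close>. Each of these equations is contracting in the \<open>x\<close>-adic
  metric, so its solution is unique, and iterating the substitution unrolls the J-fraction.
\<close>

section \<open>Power series\<close>

text \<open>Banach's fixed-point argument in the \<open>x\<close>-adic metric: coefficient
  \<open>n\<close> of \<open>P f\<close> depends only on lower coefficients of \<open>f\<close>, so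
  each iteration from \<open>0\<close> settles one more coefficient.\<close>

lemma fps_contraction_ex1:
  fixes P :: "'a::zero fps \<Rightarrow> 'a fps"
  assumes contr: "\<And>f g n. (\<And>m. m < n \<Longrightarrow> f $ m = g $ m) \<Longrightarrow> P f $ n = P g $ n"
  shows "\<exists>!f. f = P f"
proof (rule ex_ex1I)
  define h where "h n = (P ^^ n) 0" for n
  have h_Suc: "h (Suc n) = P (h n)" for n
    by (simp add: h_def)
  have step: "h (Suc n) $ m = h n $ m" if "m < n" for m n
    using that
  proof (induction n arbitrary: m)
    case (Suc n)
    have "P (h (Suc n)) $ m = P (h n) $ m"
      using Suc by (intro contr) auto
    then show ?case
      by (simp add: h_Suc)
  qed simp
  have stable: "h (Suc m + k) $ m = h (Suc m) $ m" for m k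
    by (induction k) (simp_all add: step)
  \<comment> \<open>Coefficient \<open>m\<close> no longer changes from iterate \<open>Suc m\<close>
    on, so the limit is read off the diagonal.\<close>
  define f where "f = Abs_fps (\<lambda>m. h (Suc m) $ m)"
  have f_nth: "f $ m = h n $ m" if "m < n" for m n
    using stable[of m "n - Suc m"] that by (simp add: f_def)
  have "f $ n = P f $ n" for n
  proof -
    have "f $ n = P (h n) $ n"
      by (simp add: f_def h_Suc)
    also have "\<dots> = P f $ n"
      by (rule contr) (simp add: f_nth)
    finally show ?thesis .
  qed
  then show "\<exists>f. f = P f"
    by (auto simp: fps_eq_iff)
next
  fix f g assume f: "f = P f" and g: "g = P g"
  have "f $ n = g $ n" for n
  proof (induction n rule: less_induct)
    case (less n)
    then have "P f $ n = P g $ n"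
      by (rule contr)
    then show ?case
      using f g by simp
  qed
  then show "f = g"
    by (simp add: fps_eq_iff)
qed

text \<open>The factor \<open>fps_X\<close> delays the dependence on \<open>f\<close> by one degree,
  which makes the right-hand side contracting.\<close>

lemma fps_quadratic_ex1:
  fixes p q c :: "'a::comm_ring_1 fps"
  shows "\<exists>!f. f = c + fps_X * (p * f ^ 2 + q * f)"
proof (rule fps_contraction_ex1)
  fix f g :: "'a fps" and n
  assume eq: "\<And>m. m < n \<Longrightarrow> f $ m = g $ m"
  have mult: "(r * h) $ m = (r' * h') $ m"
    if "\<And>i. i \<le> m \<Longrightarrow> r $ i = r' $ i" "\<And>i. i \<le> m \<Longrightarrow> h $ i = h' $ i"
    for r r' h h' :: "'a fps" and m
    unfolding fps_mult_nth using that by (intro sum.cong) auto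
  have "(p * f ^ 2 + q * f) $ m = (p * g ^ 2 + q * g) $ m" if "m < n" for m
    using eq that by (auto intro!: arg_cong2[where f = "(+)"] mult simp: power2_eq_square)
  then show "(c + fps_X * (p * f ^ 2 + q * f)) $ n = (c + fps_X * (p * g ^ 2 + q * g)) $ n"
    by (cases n) auto
qed

section \<open>Convergence of J-fractions\<close>

lemma fps_divide_eq_iff:
  fixes U :: "'a::field fps"
  assumes "U $ 0 \<noteq> 0"
  shows "f = c / U \<longleftrightarrow> f * U = c"
  using assms by (metis dvd_div_mult_self fps_is_unit_iff nonzero_mult_div_cancel_right
      fps_nonzero_nth unit_imp_dvd)

text \<open>The \<open>F k\<close> play the role of the infinite tails. Truncation replaces the
  deepest tail by \<open>0\<close>, and each level above it multiplies the error by a multiple of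
  \<open>fps_X ^ 2\<close>.\<close>

lemma J_convergent_nth_eq:
  fixes F :: "nat \<Rightarrow> 'a::field fps"
  assumes tail: "\<And>k. F k * (1 + fps_const (u (Suc k)) * fps_X - fps_X ^ 2 * F (Suc k))
                     = fps_const (v k)"
    and "m < n"
  shows "J_convergent u v k n $ m = F k $ m"
  using \<open>m < n\<close>
proof (induction n arbitrary: k m)
  case (Suc n)
  define J where "J = J_convergent u v (Suc k) n"
  define D where "D G = 1 + fps_const (u (Suc k)) * fps_X - fps_X ^ 2 * G" for G :: "'a fps"
  have D0: "D G $ 0 \<noteq> 0" for G
    by (simp add: D_def)
  have J: "J_convergent u v k (Suc n) * D J = fps_const (v k)"
    using fps_divide_eq_iff[OF D0] by (simp add: D_def J_def)
  have F: "F k * D (F (Suc k)) = fps_const (v k)"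
    using tail by (simp add: D_def)
  have solve: "p = q * inverse (D J)" if "p * D J = q" for p q
    using inverse_mult_eq_1'[OF D0] that by (auto simp: mult.assoc)
  have "(J_convergent u v k (Suc n) - F k) * D J = F k * (fps_X ^ 2 * (J - F (Suc k)))"
    using J F by (simp add: D_def algebra_simps)
  from solve[OF this] have "J_convergent u v k (Suc n) - F k
      = fps_X ^ 2 * (J - F (Suc k)) * (F k * inverse (D J))"
    by (simp only: ac_simps)
  moreover have "(fps_X ^ 2 * (J - F (Suc k)) * H) $ m = 0" for H
  proof -
    have "(fps_X ^ 2 * (J - F (Suc k))) $ i = 0" if "i \<le> m" for i
      using that Suc.prems Suc.IH[of "i - 2" "Suc k"] by (auto simp: fps_X_power_mult_nth J_def)
    then show ?thesis
      unfolding fps_mult_nth[of "fps_X ^ 2 * _"] by (intro sum.neutral) auto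
  qed
  ultimately have "(J_convergent u v k (Suc n) - F k) $ m = 0"
    by simp
  then show ?case
    by simp
qed simp

lemma has_J_fraction_tailsI:
  fixes F :: "nat \<Rightarrow> 'a::field fps"
  assumes "\<And>k. F k * (1 + fps_const (u (Suc k)) * fps_X - fps_X ^ 2 * F (Suc k))
                = fps_const (v k)"
  shows "has_J_fraction (F 0) u v"
  unfolding has_J_fraction_def
proof (rule tendsto_fpsI)
  fix m
  show "\<forall>\<^sub>F n in sequentially. J_convergent u v 0 n $ m = F 0 $ m"
    using eventually_gt_at_top[of m] J_convergent_nth_eq[of F u v, OF assms] by (rule eventually_mono)
qed

section \<open>The quadratic equation\<close>

text \<open>With \<open>p\<close> and \<open>q\<close> as below, passing from \<open>L\<close> to
  \<open>- t * L\<close> divides \<open>p\<close> by \<open>- t\<close> and multiplies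
  \<open>q\<close> by \<open>- t\<close>. Hence \<open>A\<close> obeys a linear recurrence with
  characteristic roots \<open>- t\<close> and \<open>- 1 / t\<close>; their product is 1, which
  makes the third expression invariant.\<close>

lemma alpha_consecutive:
  fixes z t L :: "'a::field"
  assumes t: "t \<noteq> 0" "t ^ 2 \<noteq> 1" and L: "L \<noteq> 0"
  defines "A \<equiv> coeff_alpha z t"
  shows "coeff_d z t L = - (A L ^ 2)"
    and "coeff_b z t L = A L * A (- L / t)"
    and "coeff_a z t L = A L ^ 2 - A (- t * L) * A (- L / t)"
    and "A (- t * L) + A (- L / t) = - ((t + inverse t) * A L)"
proof -
  have e: "1 - t ^ 2 \<noteq> 0" using t by simp
  define e where "e = 1 - t ^ 2"
  have e0: "e \<noteq> 0" and g1: "gamma1 t = - e"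
    using e by (simp_all add: e_def gamma1_def power2_eq_square algebra_simps)
  define p q where "p = gamma2 z t / (e * L)" and "q = gamma3 z t * L / e"
  have A: "A L = - p - q * t" "A (- t * L) = p / t + q * t ^ 2" "A (- L / t) = p * t + q"
    using t L e0 unfolding A_def coeff_alpha_def p_def q_def e_def[symmetric]
    by (simp_all add: field_simps power2_eq_square)
  have pq: "gamma2 z t = p * e * L" "gamma3 z t = q * e / L"
    using L e0 by (simp_all add: p_def q_def)
  show "coeff_d z t L = - (A L ^ 2)"
    unfolding coeff_d_def A g1 pq using t L e0 by (simp add: field_simps power2_eq_square)
  show "coeff_b z t L = A L * A (- L / t)"
    unfolding coeff_b_def A g1 pq using t L e0 by (simp add: field_simps power2_eq_square)
  show "A (- t * L) + A (- L / t) = - ((t + inverse t) * A L)"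
    unfolding A using t by (simp add: field_simps power2_eq_square)
  \<comment> \<open>The bridge to \<open>p\<close> and \<open>q\<close> is the factorisation of
    \<open>coeff_a\<close>: the product \<open>p * q\<close> is free of \<open>L\<close>.\<close>
  have "coeff_a z t L = - (gamma2 z t * gamma3 z t / t)"
    unfolding coeff_a_def gamma2_def gamma3_def using t
    by (simp add: field_simps power2_eq_square)
  also have "\<dots> = - (p * q * e ^ 2 / t)"
    unfolding pq using L by (simp add: field_simps power2_eq_square)
  also have "\<dots> = A L ^ 2 - A (- t * L) * A (- L / t)"
    unfolding A e_def using t by (simp add: field_simps power2_eq_square)
  finally show "coeff_a z t L = A L ^ 2 - A (- t * L) * A (- L / t)" .
qed

text \<open>\<open>B\<close>, \<open>A\<close>, \<open>C\<close> stand for three consecutive terms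
  of the sequence of alphas. With \<open>z\<close> and \<open>t\<close> eliminated, going one period
  deeper is the shift to \<open>A\<close>, \<open>C\<close>, \<open>E\<close>.\<close>

definition alpha_quadratic :: "'a::comm_ring_1 \<Rightarrow> 'a \<Rightarrow> 'a \<Rightarrow> 'a \<Rightarrow> 'a fps \<Rightarrow> bool" where
  "alpha_quadratic s B A C f \<longleftrightarrow>
     (fps_const (A ^ 2 - C * B) * fps_X ^ 4
       + fps_const (A * B) * (1 - fps_const s * fps_X) * fps_X ^ 2) * f ^ 2
     + (fps_const (A * (C - B)) * fps_X ^ 2 - fps_const (A ^ 2) * (1 - fps_const s * fps_X)) * f
     + fps_const (A ^ 2) = 0"

lemma quadratic_eq_iff_alpha_quadratic:
  fixes z t L :: "'a::field"
  assumes "t \<noteq> 0" "t ^ 2 \<noteq> 1" "L \<noteq> 0"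
  shows "quadratic_eq s z t L f \<longleftrightarrow>
    alpha_quadratic s (coeff_alpha z t (- L / t)) (coeff_alpha z t L) (coeff_alpha z t (- t * L)) f"
proof -
  define B A C where "B = coeff_alpha z t (- L / t)" and "A = coeff_alpha z t L"
    and "C = coeff_alpha z t (- t * L)"
  note c = alpha_consecutive[OF assms, of z, folded B_def A_def C_def]
  \<comment> \<open>The recurrence for consecutive terms removes the last explicit \<open>t\<close>
    from the linear coefficient.\<close>
  have "(t + inverse t) * - (A ^ 2) - 2 * (A * B) = A * (- ((t + inverse t) * A) - 2 * B)"
    by (simp add: algebra_simps power2_eq_square)
  also have "\<dots> = A * (C - B)"
    unfolding c(4)[symmetric] by (simp add: algebra_simps)
  finally have e: "(t + inverse t) * - (A ^ 2) - 2 * (A * B) = A * (C - B)" .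
  show ?thesis
    unfolding quadratic_eq_def alpha_quadratic_def Let_def c(1-3) e B_def[symmetric] A_def[symmetric] C_def[symmetric]
      add_eq_0_iff2
    by (simp add: algebra_simps power2_eq_square power3_eq_cube power4_eq_xxxx
        flip: fps_const_mult fps_const_neg)
qed

text \<open>After division by \<open>A ^ 2\<close> and isolation of \<open>f\<close>, every
  remaining term except the constant 1 has a factor \<open>fps_X\<close>.\<close>

lemma alpha_quadratic_ex1:
  fixes A :: "'a::field"
  assumes "A \<noteq> 0"
  shows "\<exists>!f. alpha_quadratic s B A C f"
proof -
  define p q where
    "p = fps_const ((A ^ 2 - C * B) / A ^ 2) * fps_X ^ 3
         + fps_const (B / A) * (1 - fps_const s * fps_X) * fps_X"
    and "q = fps_const ((C - B) / A) * fps_X + fps_const s"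
  have k: "fps_const (A ^ 2 - C * B) = fps_const (A ^ 2) * fps_const ((A ^ 2 - C * B) / A ^ 2)"
    "fps_const (A * B) = fps_const (A ^ 2) * fps_const (B / A)"
    "fps_const (A * (C - B)) = fps_const (A ^ 2) * fps_const ((C - B) / A)"
    using assms by (simp_all add: power2_eq_square)
  have "alpha_quadratic s B A C f \<longleftrightarrow>
    fps_const (A ^ 2) * (1 + fps_X * (p * f ^ 2 + q * f) - f) = 0" for f
    unfolding alpha_quadratic_def k p_def q_def
    by (simp add: algebra_simps power2_eq_square power3_eq_cube power4_eq_xxxx
        del: fps_const_mult)
  moreover have "fps_const (A ^ 2) \<noteq> 0"
    using assms by simp
  ultimately have "alpha_quadratic s B A C f \<longleftrightarrow> f = 1 + fps_X * (p * f ^ 2 + q * f)" for f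
    by (metis mult_eq_0_iff right_minus_eq)
  then show ?thesis
    using fps_quadratic_ex1[of 1 p q] by simp
qed

lemma alpha_quadratic_nth_0:
  fixes A :: "'a::field"
  assumes "A \<noteq> 0" "alpha_quadratic s B A C f"
  shows "f $ 0 = 1"
proof -
  have "- (A ^ 2 * f $ 0) + A ^ 2 = 0"
    using arg_cong[OF assms(2)[unfolded alpha_quadratic_def], of "\<lambda>h. h $ 0"] by simp
  then show ?thesis
    using assms(1) by simp
qed

text \<open>One period of the fraction: the series \<open>f'\<close> built from \<open>g\<close> is
  shown to solve the equation of \<open>f\<close>, and uniqueness identifies the two.\<close>

lemma alpha_quadratic_step:
  fixes A :: "'a::field"
  assumes A: "A \<noteq> 0" "C \<noteq> 0" and inv: "C ^ 2 - E * A = A ^ 2 - C * B"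
    and f: "alpha_quadratic s B A C f" and g: "alpha_quadratic s A C E g"
    and h: "h * (1 - fps_X ^ 2 * (fps_const (A / C) * g)) = fps_const (C / A)"
  shows "f * (1 - fps_const s * fps_X - fps_X ^ 2 * h) = 1"
proof -
  define w where "w = 1 - fps_const s * fps_X"
  define U where "U = w - fps_X ^ 2 * h"
  have U0: "U $ 0 = 1"
    by (simp add: U_def w_def)
  define f' where "f' = inverse U"
  have f'U: "f' * U = 1"
    unfolding f'_def by (rule inverse_mult_eq_1) (simp add: U0)
  \<comment> \<open>Clearing denominators gives \<open>h = C ^ 2 / M\<close> and
    \<open>U = D / M\<close>, so \<open>f' = M / D\<close> is a Moebius transform of
    \<open>g\<close>.\<close>
  define M where "M = fps_const (A * C) - fps_const (A ^ 2) * (fps_X ^ 2 * g)"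
  define D where "D = M * w - fps_const (C ^ 2) * fps_X ^ 2"
  have "h * (fps_const (A * C) * (1 - fps_X ^ 2 * (fps_const (A / C) * g)))
      = fps_const (A * C) * fps_const (C / A)"
    using h by (metis mult.left_commute)
  moreover have "fps_const (A * C) * (1 - fps_X ^ 2 * (fps_const (A / C) * g)) = M"
    using A by (simp add: M_def right_diff_distrib mult.left_commute[of "fps_X ^ 2"]
        flip: mult.assoc) (simp add: power2_eq_square)
  ultimately have hM: "h * M = fps_const (C ^ 2)"
    using A by (simp add: power2_eq_square)
  have "M * U = D"
    by (simp add: U_def D_def right_diff_distrib flip: hM)
  then have f'D: "f' * D = M"
    using f'U by (metis mult.left_commute mult.right_neutral)
  define a b e x where "a = fps_const A" and "b = fps_const B" and "e = fps_const E"
    and "x = (fps_X :: 'a fps)"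
  define c where "c = fps_const C"
  note folds = a_def[symmetric] b_def[symmetric] c_def[symmetric] e_def[symmetric]
    x_def[symmetric] fps_const_mult[symmetric] fps_const_sub[symmetric]
    fps_const_power[symmetric]
  have inv': "c ^ 2 - e * a = a ^ 2 - c * b"
    using arg_cong[OF inv, of fps_const] unfolding folds .
  have g': "((c ^ 2 - e * a) * x ^ 4 + c * a * w * x ^ 2) * g ^ 2
      + (c * (e - a) * x ^ 2 - c ^ 2 * w) * g + c ^ 2 = 0"
    using g unfolding alpha_quadratic_def w_def[symmetric] unfolding folds .
  have M: "M = a * c - a ^ 2 * (x ^ 2 * g)" and D: "D = M * w - c ^ 2 * x ^ 2"
    unfolding M_def D_def folds by (rule refl)+
  \<comment> \<open>The equation for \<open>M / D\<close> multiplied by \<open>D ^ 2\<close>: a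
    polynomial consequence of \<open>inv'\<close> and \<open>g'\<close>. The factor
    \<open>D ^ 2\<close> cancels later because \<open>D\<close> has constant term
    \<open>A * C\<close>.\<close>
  have "((a ^ 2 - c * b) * x ^ 4 + a * b * w * x ^ 2) * M ^ 2
      + (a * (c - b) * x ^ 2 - a ^ 2 * w) * M * D + a ^ 2 * D ^ 2 = 0"
    using inv' g' M D by algebra
  moreover have "p * M ^ 2 + q * M * D + r * D ^ 2 = D ^ 2 * (p * f' ^ 2 + q * f' + r)" for p q r
    unfolding f'D[symmetric] by (simp add: algebra_simps power2_eq_square)
  moreover have "D $ 0 \<noteq> 0"
    using A by (simp add: D_def M_def w_def)
  then have "D ^ 2 \<noteq> 0"
    by auto
  ultimately have "alpha_quadratic s B A C f'"
    unfolding alpha_quadratic_def w_def[symmetric] unfolding folds by (metis mult_eq_0_iff)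
  then have "f = f'"
    using alpha_quadratic_ex1[OF A(1)] f by blast
  then show ?thesis
    using f'U by (simp add: U_def w_def)
qed

text \<open>Over an arbitrary field, so that rational functions matter only for checking the
  non-vanishing conditions.\<close>

theorem quadratic_eq_J_fraction:
  fixes s z t K :: "'a::field"
  assumes t: "t \<noteq> 0" "t ^ 2 \<noteq> 1" and K: "K \<noteq> 0"
    and alpha: "\<And>j. coeff_alpha z t ((- t) ^ j * K) \<noteq> 0"
    and u: "\<And>j. u (2 * j + 1) = - s" "\<And>j. u (2 * j + 2) = 0"
    and v: "v 0 = 1"
      "\<And>j. v (2 * j + 1) =
           coeff_alpha z t ((- t) ^ (j + 1) * K) / coeff_alpha z t ((- t) ^ j * K)"
      "\<And>j. v (2 * j + 2) =
           coeff_alpha z t ((- t) ^ j * K) / coeff_alpha z t ((- t) ^ (j + 1) * K)"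
  shows "\<exists>!f. quadratic_eq s z t K f"
    and "quadratic_eq s z t K f \<Longrightarrow> f $ 0 = 1"
    and "quadratic_eq s z t K f \<Longrightarrow> has_J_fraction f u v"
proof -
  define A where "A j = coeff_alpha z t ((- t) ^ j * K)" for j
  \<comment> \<open>The predecessor of \<open>A j\<close>, given by its own formula because
    \<open>j = 0\<close> needs the term with index -1.\<close>
  define B where "B j = coeff_alpha z t (- ((- t) ^ j * K) / t)" for j
  have L: "(- t) ^ j * K \<noteq> 0" for j
    using t K by simp
  have A0: "A j \<noteq> 0" for j
    using alpha by (simp add: A_def)
  have A_Suc: "coeff_alpha z t (- t * ((- t) ^ j * K)) = A (Suc j)" for j
    by (simp add: A_def mult.assoc)
  have B_Suc: "B (Suc j) = A j" for j
    using t by (simp add: A_def B_def)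
  have quad: "quadratic_eq s z t ((- t) ^ j * K) f
      \<longleftrightarrow> alpha_quadratic s (B j) (A j) (A (Suc j)) f" for j f
    unfolding quadratic_eq_iff_alpha_quadratic[OF t L] A_Suc
    by (simp add: A_def B_def)
  have quad0: "quadratic_eq s z t K f \<longleftrightarrow> alpha_quadratic s (B 0) (A 0) (A 1) f" for f
    using quad[of 0] by simp
  show "\<exists>!f. quadratic_eq s z t K f"
    unfolding quad0 by (rule alpha_quadratic_ex1[OF A0])
  show "f $ 0 = 1" if "quadratic_eq s z t K f"
    by (rule alpha_quadratic_nth_0[OF A0 that[unfolded quad0]])
  \<comment> \<open>Both sides are values of \<open>coeff_a\<close>, which is constant in its last
    argument.\<close>
  have inv: "A (Suc j) ^ 2 - A (Suc (Suc j)) * A j = A j ^ 2 - A (Suc j) * B j" for j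
  proof -
    have inv: "coeff_a z t ((- t) ^ i * K) = A i ^ 2 - A (Suc i) * B i" for i
      using alpha_consecutive(3)[OF t L[of i], of z] unfolding A_Suc by (simp add: A_def B_def)
    have "coeff_a z t ((- t) ^ Suc j * K) = coeff_a z t ((- t) ^ j * K)"
      by (simp add: coeff_a_def)
    then show ?thesis
      unfolding inv B_Suc .
  qed
  show "has_J_fraction f u v" if f: "quadratic_eq s z t K f"
  proof -
    define sol where "sol j = (THE f. alpha_quadratic s (B j) (A j) (A (Suc j)) f)" for j
    have sol: "alpha_quadratic s (B j) (A j) (A (Suc j)) (sol j)" for j
      unfolding sol_def by (rule theI') (rule alpha_quadratic_ex1[OF A0])
    have f_sol: "f = sol 0"
      using alpha_quadratic_ex1[OF A0] sol[of 0] f unfolding quad0 One_nat_def by blast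
    define D where "D j = 1 - fps_X ^ 2 * (fps_const (A j / A (Suc j)) * sol (Suc j))" for j
    define odd where "odd j = fps_const (A (Suc j) / A j) * inverse (D j)" for j
    have odd: "odd j * D j = fps_const (A (Suc j) / A j)" for j
      unfolding odd_def mult.assoc by (subst inverse_mult_eq_1) (simp_all add: D_def)
    have step: "sol j * (1 - fps_const s * fps_X - fps_X ^ 2 * odd j) = 1" for j
      using A0 A0 inv sol sol[of "Suc j", unfolded B_Suc] odd[unfolded D_def]
      by (rule alpha_quadratic_step)
    \<comment> \<open>The tails: even levels carry the solution at \<open>(- t) ^ j * K\<close>,
      scaled by the partial numerator; odd levels carry the intermediate series \<open>h\<close> of
      the step lemma.\<close>
    define F where "F k = (if even k then fps_const (v k) * sol (k div 2) else odd (k div 2))"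
      for k
    have v': "v (Suc (2 * j)) = A (Suc j) / A j" "v (Suc (Suc (2 * j))) = A j / A (Suc j)" for j
      using v(2,3)[of j] by (simp_all add: A_def)
    have u': "u (Suc (2 * j)) = - s" "u (Suc (Suc (2 * j))) = 0" for j
      using u[of j] by simp_all
    have "F k * (1 + fps_const (u (Suc k)) * fps_X - fps_X ^ 2 * F (Suc k)) = fps_const (v k)"
      for k
    proof (cases "even k")
      case True
      then obtain j where k: "k = 2 * j" by blast
      have "F k * (1 + fps_const (u (Suc k)) * fps_X - fps_X ^ 2 * F (Suc k))
          = fps_const (v k) * (sol j * (1 - fps_const s * fps_X - fps_X ^ 2 * odd j))"
        by (simp add: F_def k u' mult.assoc flip: fps_const_neg)
      then show ?thesis
        by (simp add: step)
    next
      case False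
      then obtain j where k: "k = Suc (2 * j)" by (metis oddE Suc_eq_plus1)
      show ?thesis
        using odd[of j] by (simp add: F_def k u' v' D_def)
    qed
    then have "has_J_fraction (F 0) u v"
      by (rule has_J_fraction_tailsI)
    then show ?thesis
      by (simp add: F_def v(1) f_sol)
  qed
qed

section \<open>The field of rational functions\<close>

lemma to_fract_power: "to_fract (p ^ n) = to_fract p ^ n"
  by (induction n) simp_all

lemma var_nonzero:
  shows "var_t \<noteq> (0 :: 'a::field_char_0 ratfun)"
    and "var_t ^ 2 \<noteq> (1 :: 'a ratfun)"
    and "var_K \<noteq> (0 :: 'a ratfun)"
proof -
  have "var_t ^ 2 - 1 = to_fract ([:[:0, 1:]:] ^ 2 - (1 :: 'a poly poly poly poly))"
    by (simp add: var_t_def to_fract_power)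
  moreover have "[:[:0, 1:]:] ^ 2 - (1 :: 'a poly poly poly poly) \<noteq> 0"
  proof
    assume "[:[:0, 1:]:] ^ 2 - (1 :: 'a poly poly poly poly) = 0"
    from arg_cong[OF this, of "\<lambda>p. poly (poly p 0) 0"] show False
      by simp
  qed
  ultimately show "var_t ^ 2 \<noteq> (1 :: 'a ratfun)"
    by (metis to_fract_eq_0_iff right_minus_eq)
qed (simp_all add: var_t_def var_K_def)

text \<open>Clearing denominators leaves a polynomial whose value at \<open>K = 0\<close>,
  \<open>t = 0\<close> is -1.\<close>

lemma coeff_alpha_var_nonzero:
  "coeff_alpha var_z var_t ((- var_t) ^ j * var_K) \<noteq> (0 :: 'a::field_char_0 ratfun)"
proof
  define z t L :: "'a ratfun" where "z = var_z" and "t = var_t" and "L = (- var_t) ^ j * var_K"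
  assume "coeff_alpha var_z var_t ((- var_t) ^ j * var_K) = (0 :: 'a ratfun)"
  then have "coeff_alpha z t L * (- (1 - t ^ 2) * L) = 0"
    by (simp add: z_def t_def L_def)
  moreover have "1 - t ^ 2 \<noteq> 0" "L \<noteq> 0"
    using var_nonzero[where ?'a = 'a] by (simp_all add: t_def L_def)
  then have "coeff_alpha z t L * (- (1 - t ^ 2) * L) = (z * t - 1) + L ^ 2 * (t - z) * t"
    unfolding coeff_alpha_def gamma2_def gamma3_def
    by (simp add: divide_simps) (simp add: algebra_simps power2_eq_square)
  ultimately have 0: "(z * t - 1) + L ^ 2 * (t - z) * t = 0"
    by metis
  define Z T M :: "'a poly poly poly poly"
    where "Z = [:[:[:0, 1:]:]:]" and "T = [:[:0, 1:]:]" and "M = (- T) ^ j * [:0, 1:]"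
  have "z = to_fract Z" "t = to_fract T" "L = to_fract M"
    unfolding M_def to_fract_mult to_fract_power to_fract_uminus
    by (simp_all add: z_def t_def L_def Z_def T_def var_z_def var_t_def var_K_def)
  then have "to_fract ((Z * T - 1) + M ^ 2 * (T - Z) * T) = 0"
    using 0 by (simp add: to_fract_power)
  then have "(Z * T - 1) + M ^ 2 * (T - Z) * T = 0"
    by (simp only: to_fract_eq_0_iff)
  from arg_cong[OF this, of "\<lambda>p. poly (poly p 0) 0"] show False
    by (simp add: Z_def T_def M_def)
qed

theorem theorem3p5:
  fixes s z t K :: "'a::field_char_0 ratfun"
    and u v :: "nat \<Rightarrow> 'a ratfun"
  assumes "s = var_s" and "z = var_z" and "t = var_t" and "K = var_K"
    and "\<And>j. u (2 * j + 1) = - s"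
    and "\<And>j. u (2 * j + 2) = 0"
    and "v 0 = 1"
    and "\<And>j. v (2 * j + 1) =
           coeff_alpha z t ((- t) ^ (j + 1) * K) / coeff_alpha z t ((- t) ^ j * K)"
    and "\<And>j. v (2 * j + 2) =
           coeff_alpha z t ((- t) ^ j * K) / coeff_alpha z t ((- t) ^ (j + 1) * K)"
  shows "(\<exists>!f. fps_nth f 0 = 1 \<and> quadratic_eq s z t K f) \<and>
         (\<forall>f. fps_nth f 0 = 1 \<and> quadratic_eq s z t K f \<longrightarrow> has_J_fraction f u v)"
proof -
  note nonzero = var_nonzero[where ?'a = 'a, folded assms(1-4)]
    coeff_alpha_var_nonzero[where ?'a = 'a, folded assms(1-4)]
  note J = quadratic_eq_J_fraction[of t K z u s v, OF nonzero assms(5-9)]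
  show ?thesis
    using J by metis
qed

end
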